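(* Let $w\in\mathbb{C}$ with $\operatorname{Re}(w)>-1$ and let $z\in\mathbb{C}$. Then the following series converges absolutely and $$\sum_{k=0}^{\infty}\binom{w}{k}\binom{k}{z}\binom{z}{k}=\binom{w}{z}.$$
   Context: For $u\in\mathbb{C}$ not a negative integer and $z\in\mathbb{C}$, the generalized binomial coefficient is $\binom{u}{z}=\frac{\Gamma(u+1)}{\Gamma(z+1)\Gamma(u-z+1)}$, where the reciprocal gamma function $1/\Gamma$ is understood as an entire function (equal to $0$ at the nonpositive integers). For every $u\in\mathbb{C}$ (including negative integers) and integer $k\ge 1$, $\binom{u}{k}=\frac{u(u-1)\cdots(u-k+1)}{k!}$, and $\binom{u}{0}=1$; the two definitions agree where both apply. *)

theory Defs
  imports "HOL-Analysis.Gamma_Function"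
begin

text \<open>
  The binomial coefficient with complex lower argument; meaningful only when \<open>u\<close> is not a negative
  integer. For a natural number as lower argument and arbitrary \<open>u\<close>, the falling factorial
  definition is the library's \<open>u gchoose k\<close>.
\<close>
definition cbinom :: "complex \<Rightarrow> complex \<Rightarrow> complex" where
  "cbinom u z = Gamma (u + 1) * rGamma (z + 1) * rGamma (u - z + 1)"

lemma cbinom_of_nat:
  assumes "u + 1 \<notin> \<int>\<^sub>\<le>\<^sub>0"
  shows "cbinom u (of_nat k) = u gchoose k"
proof -
  have "rGamma (of_nat k + 1 :: complex) = inverse (fact k)"
    by (simp add: rGamma_inverse_Gamma Gamma_fact add.commute)
  then show ?thesis
    using gbinomial_Gamma[OF assms, of k]
    by (simp add: cbinom_def rGamma_inverse_Gamma field_simps)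
qed

end

theory Submission
  imports Defs
begin

text \<open>
  Unless \<open>z\<close> is a positive integer (when only the term \<open>k = z\<close> survives), the series is a constant
  multiple of \<open>\<^sub>2F\<^sub>1(-w, -z; 1 - z; 1)\<close>, so Gauss's summation theorem applies. To prove the latter, a
  telescoping contiguous relation expresses the sum at \<open>c\<close> through the sum at \<open>c + 1\<close>; as the shift
  tends to infinity, the sum tends to 1 by dominated convergence, and the accumulated factor is a
  quotient of Gamma products in Euler's limit form.
\<close>

section \<open>Terms of the Gauss series and their growth\<close>

definition hypergeo_term :: "complex \<Rightarrow> complex \<Rightarrow> complex \<Rightarrow> nat \<Rightarrow> complex" where
  "hypergeo_term a b c k = pochhammer a k * pochhammer b k / (pochhammer c k * fact k)"

lemma hypergeo_term_0 [simp]: "hypergeo_term a b c 0 = 1"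
  by (simp add: hypergeo_term_def)

lemma hypergeo_term_Suc:
  "hypergeo_term a b c (Suc k) =
     hypergeo_term a b c k * ((a + of_nat k) * (b + of_nat k) / ((c + of_nat k) * (1 + of_nat k)))"
  by (simp add: hypergeo_term_def pochhammer_rec' mult_ac)

text \<open>By Euler's limit formula, the term of index n + 1 is n^(a + b - c - 1) times a
  convergent, hence bounded, sequence. If c is a nonpositive integer, late terms and late values of
  \<open>Gamma_series c\<close> are both 0 through division by zero. The case n = 0 is left out
  because \<open>0 powr x\<close> is 0.\<close>

lemma hypergeo_term_bound:
  obtains B where "B \<ge> 0"
    "\<And>n. n > 0 \<Longrightarrow> norm (hypergeo_term a b c (Suc n)) \<le> B * of_nat n powr (Re (a + b - c) - 1)"
proof -
  define L where
    "L = (\<lambda>n. rGamma_series a n * rGamma_series b n * (Gamma_series c n * Gamma_series 1 n))"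
  have "L \<longlonglongrightarrow> rGamma a * rGamma b * (Gamma c * Gamma 1)"
    unfolding L_def by (intro tendsto_intros)
  then have "Bseq L"
    by (rule convergentI[THEN convergent_imp_Bseq])
  then obtain B where B: "B > 0" "\<And>n. norm (L n) \<le> B"
    by (auto elim: BseqE)
  have "norm (hypergeo_term a b c (Suc n)) \<le> B * of_nat n powr (Re (a + b - c) - 1)"
    if "n > 0" for n
  proof -
    let ?l = "of_real (ln (of_nat n)) :: complex"
    have "hypergeo_term a b c (Suc n) = L n * (exp (a * ?l) * exp (b * ?l) / (exp (c * ?l) * exp ?l))"
      by (simp add: L_def hypergeo_term_def rGamma_series_def Gamma_series_def field_simps
            flip: pochhammer_fact del: fact_Suc)
    also have "exp (a * ?l) * exp (b * ?l) / (exp (c * ?l) * exp ?l) = exp ((a + b - c - 1) * ?l)"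
      by (simp add: exp_add exp_diff ring_distribs)
    finally have "norm (hypergeo_term a b c (Suc n)) =
        norm (L n) * of_nat n powr (Re (a + b - c) - 1)"
      using that by (simp add: norm_mult powr_def mult.commute)
    then show ?thesis
      using B(2)[of n] by (simp add: mult_right_mono)
  qed
  then show ?thesis
    using B(1) by (intro that[of B]) auto
qed

lemma summable_norm_hypergeo_term:
  assumes "Re (c - a - b) > 0"
  shows "summable (\<lambda>k. norm (hypergeo_term a b c k))"
proof -
  obtain B where B: "\<And>n. n > 0 \<Longrightarrow>
      norm (hypergeo_term a b c (Suc n)) \<le> B * of_nat n powr (Re (a + b - c) - 1)"
    using hypergeo_term_bound by metis
  \<comment> \<open>The exponent is below -1.\<close>
  have "summable (\<lambda>n. B * of_nat n powr (Re (a + b - c) - 1))"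
    using assms by (intro summable_mult) (simp add: summable_real_powr_iff)
  then have "summable (\<lambda>n. norm (hypergeo_term a b c (Suc n)))"
    by (rule summable_comparison_test'[where N = 1]) (use B in auto)
  then show ?thesis
    by (subst (asm) summable_Suc_iff)
qed

text \<open>This removes the boundary term at infinity when the contiguous relation is telescoped.
  The extra factor k still leaves the negative exponent \<open>Re (a + b - c)\<close>.\<close>

lemma of_nat_mult_hypergeo_term_tendsto_0:
  assumes "Re (c - a - b) > 0"
  shows "(\<lambda>k. of_nat k * hypergeo_term a b c k) \<longlonglongrightarrow> 0"
proof -
  obtain B where B: "B \<ge> 0" "\<And>n. n > 0 \<Longrightarrow>
      norm (hypergeo_term a b c (Suc n)) \<le> B * of_nat n powr (Re (a + b - c) - 1)"
    using hypergeo_term_bound by metis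
  have "(\<lambda>n. of_nat n powr (Re (a + b - c))) \<longlonglongrightarrow> (0 :: real)"
    using assms by (intro tendsto_neg_powr filterlim_real_sequentially) auto
  \<comment> \<open>The 2 comes from n + 1 \<le> 2 n for n > 0.\<close>
  then have lim: "(\<lambda>n. 2 * B * of_nat n powr (Re (a + b - c))) \<longlonglongrightarrow> 0"
    by (intro tendsto_mult_right_zero)
  have bound: "norm (of_nat (Suc n) * hypergeo_term a b c (Suc n))
      \<le> 2 * B * of_nat n powr (Re (a + b - c))" if "n > 0" for n
  proof -
    have "norm (of_nat (Suc n) * hypergeo_term a b c (Suc n))
        \<le> (2 * of_nat n) * (B * of_nat n powr (Re (a + b - c) - 1))"
      unfolding norm_mult norm_of_nat using that by (intro mult_mono B) auto
    also have "\<dots> = 2 * B * of_nat n powr (Re (a + b - c))"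
      using that by (simp add: powr_diff)
    finally show ?thesis .
  qed
  have "\<forall>\<^sub>F n in sequentially. norm (of_nat (Suc n) * hypergeo_term a b c (Suc n))
      \<le> 2 * B * of_nat n powr (Re (a + b - c))"
    by (rule eventually_mono[OF eventually_gt_at_top bound])
  then have "(\<lambda>n. of_nat (Suc n) * hypergeo_term a b c (Suc n)) \<longlonglongrightarrow> 0"
    using lim by (rule Lim_null_comparison)
  then show ?thesis
    by (rule LIMSEQ_imp_Suc[where f = "\<lambda>k. of_nat k * hypergeo_term a b c k"])
qed

section \<open>Contiguous relation in the parameter c\<close>

lemma nonpos_Ints_add_of_nat_neq_0: "c \<notin> \<int>\<^sub>\<le>\<^sub>0 \<Longrightarrow> c + of_nat n \<noteq> (0 :: complex)"
  by (metis add_eq_0_iff2 minus_of_nat_in_nonpos_Ints)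

text \<open>Termwise, the two sides differ by c times the increment of the null sequence k T(k), so
  the difference telescopes.\<close>

lemma suminf_hypergeo_term_contiguous:
  assumes "Re (c - a - b) > 0" and c: "c \<notin> \<int>\<^sub>\<le>\<^sub>0"
  shows "c * (c - a - b) * (\<Sum>k. hypergeo_term a b c k) =
         (c - a) * (c - b) * (\<Sum>k. hypergeo_term a b (c + 1) k)"
proof -
  let ?T = "hypergeo_term a b c" and ?T' = "hypergeo_term a b (c + 1)"
  have c0: "c \<noteq> 0" "c + of_nat k \<noteq> 0" for k
    using c nonpos_Ints_add_of_nat_neq_0[OF c] by auto
  have step: "c * (c - a - b) * ?T k - (c - a) * (c - b) * ?T' k =
      c * (of_nat k * ?T k - of_nat (Suc k) * ?T (Suc k))" for k
  proof -
    have "pochhammer (c + 1) k = pochhammer c k * (c + of_nat k) / c"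
      using pochhammer_rec[of c k] pochhammer_Suc[of c k] c0(1) by (simp add: field_simps)
    then have T': "?T' k = ?T k * (c / (c + of_nat k))"
      by (simp add: hypergeo_term_def mult_ac)
    have T_Suc: "of_nat (Suc k) * ?T (Suc k) =
        ?T k * ((a + of_nat k) * (b + of_nat k) / (c + of_nat k))"
      using of_nat_neq_0[of k, where ?'a = complex] by (simp add: hypergeo_term_Suc)
    \<comment> \<open>With \<open>?T k\<close> and c / (c + k) factored out, this is the polynomial
      identity (c - a - b)(c + k) - (c - a)(c - b) = k (c + k) - (a + k)(b + k).\<close>
    show ?thesis
      unfolding T' T_Suc using c0(2)[of k] by (simp add: field_simps)
  qed
  have "summable ?T" "summable ?T'"
    using assms by (auto intro!: summable_norm_cancel[OF summable_norm_hypergeo_term])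
  then have "(\<lambda>k. c * (c - a - b) * ?T k - (c - a) * (c - b) * ?T' k) sums
      (c * (c - a - b) * suminf ?T - (c - a) * (c - b) * suminf ?T')"
    by (intro sums_diff sums_mult summable_sums)
  then have "(\<lambda>k. c * (of_nat k * ?T k - of_nat (Suc k) * ?T (Suc k))) sums
      (c * (c - a - b) * suminf ?T - (c - a) * (c - b) * suminf ?T')"
    unfolding step .
  \<comment> \<open>Both boundary terms vanish: at k = 0 through the factor k, at infinity by the
    growth bound.\<close>
  moreover have "(\<lambda>k. c * (of_nat k * ?T k - of_nat (Suc k) * ?T (Suc k))) sums
      (c * (of_nat 0 * ?T 0 - 0))"
    by (intro sums_mult telescope_sums' of_nat_mult_hypergeo_term_tendsto_0 assms)
  ultimately have "c * (c - a - b) * suminf ?T - (c - a) * (c - b) * suminf ?T' =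
      c * (of_nat 0 * ?T 0 - 0)"
    by (rule sums_unique2)
  then show ?thesis by simp
qed

text \<open>Iterates the contiguous relation. The form without division lets each Pochhammer factor
  become an \<open>rGamma_series\<close> later.\<close>

lemma suminf_hypergeo_term_shift:
  assumes "Re (c - a - b) > 0" and c: "c \<notin> \<int>\<^sub>\<le>\<^sub>0"
  shows "pochhammer c n * pochhammer (c - a - b) n * (\<Sum>k. hypergeo_term a b c k) =
         pochhammer (c - a) n * pochhammer (c - b) n * (\<Sum>k. hypergeo_term a b (c + of_nat n) k)"
proof (induction n)
  case (Suc n)
  let ?S = "\<lambda>n. \<Sum>k. hypergeo_term a b (c + of_nat n) k"
  let ?c = "c + of_nat n"
  \<comment> \<open>The hypotheses survive the shift: if c + n were a nonpositive integer, so would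
    be c, and the real part of c + n - a - b only grows.\<close>
  have "?c \<notin> \<int>\<^sub>\<le>\<^sub>0"
    using c nonpos_Ints_diff_Nats[of ?c "of_nat n"] by auto
  then have *: "?c * (?c - a - b) * ?S n = (?c - a) * (?c - b) * ?S (Suc n)"
    using suminf_hypergeo_term_contiguous[of ?c a b] assms by (simp add: add_ac)
  have "pochhammer c (Suc n) * pochhammer (c - a - b) (Suc n) * (\<Sum>k. hypergeo_term a b c k) =
      ?c * (?c - a - b) * (pochhammer c n * pochhammer (c - a - b) n * (\<Sum>k. hypergeo_term a b c k))"
    by (simp add: pochhammer_Suc algebra_simps)
  also have "\<dots> = pochhammer (c - a) n * pochhammer (c - b) n * (?c * (?c - a - b) * ?S n)"
    unfolding Suc.IH by (simp add: mult_ac)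
  also have "\<dots> = pochhammer (c - a) (Suc n) * pochhammer (c - b) (Suc n) * ?S (Suc n)"
    unfolding * by (simp add: pochhammer_Suc algebra_simps)
  finally show ?case .
qed simp

section \<open>The limit of large shift\<close>

lemma norm_pochhammer_mono:
  assumes "Re c \<ge> 0"
  shows "norm (pochhammer c k) \<le> norm (pochhammer (c + of_nat n) k)"
proof -
  \<comment> \<open>Since \<open>Re c\<close> is nonnegative, the shift enlarges the real part in
    absolute value and keeps the imaginary part.\<close>
  have "norm (c + of_nat i) \<le> norm (c + of_nat n + of_nat i)" for i
  proof -
    have "(Re c + real i)\<^sup>2 \<le> (Re c + real n + real i)\<^sup>2"
      using assms by (intro power_mono) auto
    then show ?thesis
      by (simp add: cmod_def)
  qed
  then show ?thesis
    unfolding pochhammer_prod prod_norm[symmetric] by (intro prod_mono) auto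
qed

text \<open>The terms at c itself dominate those at every c + n, because \<open>Re c > 0\<close>
  makes the denominators grow in norm. Only the term k = 0 survives in the limit.\<close>

lemma suminf_hypergeo_term_tendsto_1:
  assumes c: "Re c > 0" "Re (c - a - b) > 0"
  shows "(\<lambda>n. \<Sum>k. hypergeo_term a b (c + of_nat n) k) \<longlonglongrightarrow> 1"
proof -
  have "norm (hypergeo_term a b (c + of_nat n) k) \<le> norm (hypergeo_term a b c k)" for n k
  proof -
    have "pochhammer c k \<noteq> 0"
      using c(1) by (auto simp: pochhammer_eq_0_iff)
    then show ?thesis
      using norm_pochhammer_mono[of c k n] c(1)
      unfolding hypergeo_term_def norm_divide norm_mult
      by (intro divide_left_mono mult_right_mono mult_pos_pos) auto
  qed
  moreover have "(\<lambda>n. hypergeo_term a b (c + of_nat n) k) \<longlonglongrightarrow> (if k = 0 then 1 else 0)" for k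
  proof (induction k)
    case (Suc k)
    \<comment> \<open>The ratio of consecutive terms has this quantity in its denominator, so every
      term after the first tends to 0.\<close>
    have "filterlim (\<lambda>n. (c + of_nat k) + of_nat n) at_infinity sequentially"
      by (intro tendsto_add_filterlim_at_infinity[OF tendsto_const] tendsto_of_nat)
    then have "(\<lambda>n. hypergeo_term a b (c + of_nat n) k * ((a + of_nat k) * (b + of_nat k) / (1 + of_nat k))
          / ((c + of_nat k) + of_nat n)) \<longlonglongrightarrow> 0"
      by (intro tendsto_divide_0[OF tendsto_mult[OF Suc tendsto_const]])
    then show ?case
      by (simp add: hypergeo_term_Suc add_ac mult_ac)
  qed simp
  ultimately have "(\<lambda>n. \<Sum>k. hypergeo_term a b (c + of_nat n) k) \<longlonglongrightarrow> (\<Sum>k. if k = 0 then 1 else 0)"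
    using summable_norm_hypergeo_term[OF c(2)]
    by (intro tannerys_theorem[THEN conjunct2, THEN conjunct2] always_eventually) auto
  then show ?thesis
    using suminf_finite[of "{0 :: nat}" "\<lambda>k. if k = 0 then 1 else 0 :: complex"] by simp
qed

section \<open>Gauss's summation theorem from Euler's limit formula\<close>

theorem Gauss_hypergeo_sum:
  assumes re: "Re (c - a - b) > 0" and c: "c \<notin> \<int>\<^sub>\<le>\<^sub>0"
  shows "(\<Sum>k. hypergeo_term a b c k) = Gamma c * Gamma (c - a - b) * rGamma (c - a) * rGamma (c - b)"
proof -
  let ?S = "\<lambda>n. \<Sum>k. hypergeo_term a b (c + of_nat n) k"
  \<comment> \<open>A preliminary shift by N makes the real part positive, as the limit lemma
    requires; it does not affect the limit.\<close>
  obtain N :: nat where N: "real N > - Re c"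
    using reals_Archimedean2 by blast
  have "(\<lambda>n. ?S (n + N)) \<longlonglongrightarrow> 1"
    using suminf_hypergeo_term_tendsto_1[of "c + of_nat N" a b] re N
    by (simp add: add_ac)
  then have "?S \<longlonglongrightarrow> 1"
    by (rule LIMSEQ_offset)
  then have S: "(\<lambda>n. ?S (Suc n)) \<longlonglongrightarrow> 1"
    by (rule LIMSEQ_Suc)
  have "rGamma_series c n * rGamma_series (c - a - b) n * ?S 0 =
      rGamma_series (c - a) n * rGamma_series (c - b) n * ?S (Suc n)" for n
  proof -
    let ?l = "of_real (ln (of_nat n)) :: complex"
    \<comment> \<open>The common denominator of both products of \<open>rGamma_series\<close>, since
      c + (c - a - b) = (c - a) + (c - b). Their numerators have length n + 1, hence the shift by
      \<open>Suc n\<close>.\<close>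
    define D where "D = (fact n)\<^sup>2 * exp ((c + (c - a - b)) * ?l)"
    have "rGamma_series c n * rGamma_series (c - a - b) n * ?S 0 =
        pochhammer c (Suc n) * pochhammer (c - a - b) (Suc n) * ?S 0 / D"
      by (simp add: rGamma_series_def D_def power2_eq_square algebra_simps flip: exp_add)
    also have "\<dots> = pochhammer (c - a) (Suc n) * pochhammer (c - b) (Suc n) * ?S (Suc n) / D"
      using suminf_hypergeo_term_shift[OF re c, of "Suc n"] by simp
    also have "\<dots> = rGamma_series (c - a) n * rGamma_series (c - b) n * ?S (Suc n)"
      by (simp add: rGamma_series_def D_def power2_eq_square algebra_simps flip: exp_add)
    finally show ?thesis .
  qed
  moreover have "(\<lambda>n. rGamma_series c n * rGamma_series (c - a - b) n * ?S 0) \<longlonglongrightarrow>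
      rGamma c * rGamma (c - a - b) * ?S 0"
    by (intro tendsto_intros)
  moreover have "(\<lambda>n. rGamma_series (c - a) n * rGamma_series (c - b) n * ?S (Suc n)) \<longlonglongrightarrow>
      rGamma (c - a) * rGamma (c - b) * 1"
    by (intro tendsto_intros S)
  ultimately have "rGamma c * rGamma (c - a - b) * ?S 0 = rGamma (c - a) * rGamma (c - b)"
    using LIMSEQ_unique by fastforce
  \<comment> \<open>Only the two factors on the left are divided out; \<open>rGamma (c - a)\<close>
    or \<open>rGamma (c - b)\<close> may vanish, and then the sum is 0.\<close>
  moreover have "c - a - b \<notin> \<int>\<^sub>\<le>\<^sub>0"
    using re by (metis Re_complex_of_real nonpos_Ints_cases of_int_le_0_iff
        not_less of_real_of_int_eq)
  then have "rGamma c \<noteq> 0" "rGamma (c - a - b) \<noteq> 0"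
    using c by (simp_all add: rGamma_eq_zero_iff)
  ultimately show ?thesis
    by (simp add: Gamma_def field_simps)
qed

section \<open>The binomial series\<close>

lemma cbinom_product_eq_hypergeo_term:
  assumes "1 - z \<notin> \<int>\<^sub>\<le>\<^sub>0"
  shows "(w gchoose k) * cbinom (of_nat k) z * (z gchoose k) =
         rGamma (z + 1) * rGamma (1 - z) * hypergeo_term (- w) (- z) (1 - z) k"
proof -
  have "pochhammer (1 - z) k \<noteq> 0"
    using assms pochhammer_eq_0_imp_nonpos_Int by blast
  \<comment> \<open>The middle factor depends on k only through this value and
    \<open>Gamma (k + 1)\<close>.\<close>
  then have "rGamma (of_nat k - z + 1) = rGamma (1 - z) / pochhammer (1 - z) k"
    using pochhammer_rGamma[of "1 - z" k] by (simp add: field_simps)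
  moreover have "Gamma (of_nat k + 1 :: complex) = fact k"
    by (simp add: Gamma_fact add.commute)
  \<comment> \<open>The signs from writing both \<open>gchoose\<close> factors with Pochhammer
    symbols cancel.\<close>
  moreover have "((-1) ^ k * (-1) ^ k :: complex) = 1"
    by (simp flip: power_mult_distrib)
  ultimately show ?thesis
    by (simp add: cbinom_def gbinomial_pochhammer hypergeo_term_def field_simps)
qed

theorem mainTheorem7:
  fixes w z :: complex
  assumes "Re w > -1"
  shows "summable (\<lambda>k. norm ((w gchoose k) * cbinom (of_nat k) z * (z gchoose k))) \<and>
    (\<Sum>k. (w gchoose k) * cbinom (of_nat k) z * (z gchoose k)) = cbinom w z"
proof (cases "1 - z \<in> \<int>\<^sub>\<le>\<^sub>0")
  case False
  \<comment> \<open>Here c - a - b is 1 + w.\<close>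
  have re: "Re ((1 - z) - (- w) - (- z)) > 0"
    using assms by simp
  have "Gamma (1 - z) * rGamma (1 - z) = 1"
    using False by (simp add: Gamma_def rGamma_eq_zero_iff)
  \<comment> \<open>Since c - b = 1, Gauss's value is
    \<open>Gamma (1 - z) * Gamma (w + 1) * rGamma (w - z + 1)\<close>, and its first factor
    cancels.\<close>
  then have *: "rGamma (z + 1) * rGamma (1 - z) * (\<Sum>k. hypergeo_term (- w) (- z) (1 - z) k) = cbinom w z"
    using Gauss_hypergeo_sum[OF re False] by (simp add: cbinom_def algebra_simps)
  have "summable (hypergeo_term (- w) (- z) (1 - z))"
    by (rule summable_norm_cancel[OF summable_norm_hypergeo_term[OF re]])
  then show ?thesis
    unfolding cbinom_product_eq_hypergeo_term[OF False] norm_mult *[symmetric]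
    by (intro conjI summable_mult suminf_mult summable_norm_hypergeo_term re)
next
  case True
  then obtain m where "1 - z = - of_nat m"
    by (elim nonpos_Ints_cases')
  then have z: "z = of_nat (Suc m)"
    by (simp add: algebra_simps)
  let ?f = "\<lambda>k. (w gchoose k) * cbinom (of_nat k) z * (z gchoose k)"
  have binom: "cbinom (of_nat k) z = of_nat (k choose Suc m)" for k
  proof -
    have "of_nat k + 1 \<notin> (\<int>\<^sub>\<le>\<^sub>0 :: complex set)"
      using of_nat_in_nonpos_Ints_iff[of "Suc k", where ?'a = complex] by (simp add: add.commute)
    then show ?thesis
      unfolding z by (simp add: cbinom_of_nat binomial_gbinomial del: of_nat_Suc)
  qed
  \<comment> \<open>The middle factor vanishes for k below z, the last one for k above z.\<close>
  have 0: "?f k = 0" if "k \<notin> {Suc m}" for k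
  proof (cases "k < Suc m")
    case True
    then show ?thesis by (simp add: binom)
  next
    case False
    then have "z gchoose k = 0"
      using that unfolding z by (simp flip: binomial_gbinomial del: of_nat_Suc)
    then show ?thesis by simp
  qed
  \<comment> \<open>The bound on \<open>Re w\<close> keeps w away from the negative integers, so the
    two definitions of the binomial agree.\<close>
  have "w + 1 \<notin> \<int>\<^sub>\<le>\<^sub>0"
    using assms by (auto elim!: nonpos_Ints_cases simp: complex_eq_iff)
  then have "cbinom w z = w gchoose Suc m"
    unfolding z by (rule cbinom_of_nat)
  moreover have "?f (Suc m) = w gchoose Suc m"
    unfolding binom unfolding z by (simp flip: binomial_gbinomial del: of_nat_Suc One_nat_def)
  ultimately show ?thesis
    using suminf_finite[of "{Suc m}" ?f] summable_finite[of "{Suc m}" "\<lambda>k. norm (?f k)"] 0 by auto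
qed

end
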